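(* Let $\mathfrak{g}$ be a restricted Lie algebra over $\mathbb{F}$ equipped with a symmetric invariant bilinear form $\langle\cdot,\cdot\rangle$, let $\ell\in\mathbb{F}$, and let $\chi\in\mathfrak{g}^*$ be a linear functional. Let $J_\chi$ be the $\hat{\mathfrak g}$-submodule of $V_{\hat{\mathfrak g}}(\ell,0)$ generated by the vectors $$\big(a(-m)^p-a^{[p]}(-pm)-\delta_{m,1}\chi(a)^p\big)\mathbf 1\qquad(a\in\mathfrak{g},\ m\in\mathbb{Z}_+).$$ Then $J_\chi$ is an ideal of the vertex algebra $V_{\hat{\mathfrak g}}(\ell,0)$, and it equals the ideal generated by $\big(a(-1)^p-a^{[p]}(-p)-\chi(a)^p\big)\mathbf 1$ for $a\in\mathfrak{g}$.
   Context: $\mathbb{F}$ is an algebraically closed field of prime characteristic $p\ge 3$; all vector spaces are over $\mathbb{F}$. $\mathbb{Z}_+$ denotes the positive integers. Vertex algebras: a vertex algebra is a vector space $V$ with a linear map $Y(\cdot,x):V\to(\mathrm{End}\,V)[[x,x^{-1}]]$, $v\mapsto Y(v,x)=\sum_{n\in\mathbb{Z}}v_nx^{-n-1}$, and a vector $\mathbf 1\in V$ such that $Y(u,x)v\in V((x))$; $Y(\mathbf 1,x)=\mathrm{id}$; $Y(v,x)\mathbf 1\in V[[x]]$ with constant term $v$; and for $u,v,w\in V$ the Jacobi identity $x_0^{-1}\delta\left(\frac{x_1-x_2}{x_0}\right)Y(u,x_1)Y(v,x_2)w-x_0^{-1}\delta\left(\frac{x_2-x_1}{-x_0}\right)Y(v,x_2)Y(u,x_1)w=x_2^{-1}\delta\left(\frac{x_1-x_0}{x_2}\right)Y(Y(u,x_0)v,x_2)w$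 holds, where $\delta(x)=\sum_{n\in\mathbb{Z}}x^n$ and $(x_1\pm x_2)^n$ is expanded in nonnegative powers of the second variable. An ideal is a subspace $I$ with $v_nw,\,w_nv\in I$ for all $v\in V$, $w\in I$, $n\in\mathbb{Z}$. Affine vertex algebras: $\mathfrak{g}$ is a restricted Lie algebra in Jacobson's sense with $p$-mapping $a\mapsto a^{[p]}$. $\hat{\mathfrak g}=\mathfrak{g}\otimes\mathbb{F}[t,t^{-1}]\oplus\mathbb{F}\mathbf k$ with $\mathbf k$ central and $[a\otimes t^m,b\otimes t^n]=[a,b]\otimes t^{m+n}+m\langle a,b\rangle\delta_{m+n,0}\mathbf k$; write $a(n)$ for $a\otimes t^n$. $V_{\hat{\mathfrak g}}(\ell,0)=U(\hat{\mathfrak g})\otimes_{U(\mathfrak{g}[t]\oplus\mathbb{F}\mathbf k)}\mathbb{F}_\ell$, where on $\mathbb{F}_\ell=\mathbb{F}$ the algebra $\mathfrak{g}[t]$ acts trivially and $\mathbf k$ acts as $\ell$; $\mathbf 1=1\otimes1$, and $\mathfrak{g}$ is identified with a subspace via $a\mapsto a(-1)\mathbf 1$. It has a unique vertex algebra structure with vacuum $\mathbf 1$ and $Y(a,x)=\sum_{n}a(n)x^{-n-1}$ for $a\in\mathfrak{g}$. *)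

theory Defs
  imports
    "HOL-Library.Poly_Mapping"
    "HOL-Library.Product_Plus"
    "HOL-Computational_Algebra.Computational_Algebra"
begin

section \<open>Bilinear maps, algebras and presentations\<close>

definition bilinear_map ::
  "('f::field \<Rightarrow> 'a::ab_group_add \<Rightarrow> 'a) \<Rightarrow> ('f \<Rightarrow> 'b::ab_group_add \<Rightarrow> 'b)
    \<Rightarrow> ('f \<Rightarrow> 'c::ab_group_add \<Rightarrow> 'c) \<Rightarrow> ('a \<Rightarrow> 'b \<Rightarrow> 'c) \<Rightarrow> bool"
  where "bilinear_map s1 s2 s3 B \<longleftrightarrow>
    (\<forall>x. Vector_Spaces.linear s2 s3 (B x)) \<and> (\<forall>y. Vector_Spaces.linear s1 s3 (\<lambda>x. B x y))"

locale assoc_algebra = vector_space scale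
  for scale :: "'f::field \<Rightarrow> 'u::ring_1 \<Rightarrow> 'u" +
  assumes scale_mult_left: "scale c (x * y) = scale c x * y"
    and scale_mult_right: "scale c (x * y) = x * scale c y"

text \<open>The free vector space on a type \<open>'x\<close> is \<open>'x \<Rightarrow>\<^sub>0 'f\<close>, with basis \<open>Poly_Mapping.single x 1\<close>.\<close>

definition free_scale :: "'f::field \<Rightarrow> ('x \<Rightarrow>\<^sub>0 'f) \<Rightarrow> ('x \<Rightarrow>\<^sub>0 'f)"
  where "free_scale c f = Poly_Mapping.map ((*) c) f"

definition basis_vec :: "'x \<Rightarrow> ('x \<Rightarrow>\<^sub>0 'f::field)"
  where "basis_vec x = Poly_Mapping.single x 1"

definition linear_extension ::
  "('f::field \<Rightarrow> 'w::ab_group_add \<Rightarrow> 'w) \<Rightarrow> ('x \<Rightarrow> 'w) \<Rightarrow> ('x \<Rightarrow>\<^sub>0 'f) \<Rightarrow> 'w"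
  where "linear_extension s e f = (\<Sum>x\<in>Poly_Mapping.keys f. s (Poly_Mapping.lookup f x) (e x))"

text \<open>
  \<open>presented_by s e R\<close>: via \<open>e\<close>, the space \<open>'w\<close> is the quotient of the free vector space on \<open>'x\<close>
  by the span of \<open>R\<close>.
\<close>

definition presented_by ::
  "('f::field \<Rightarrow> 'w::ab_group_add \<Rightarrow> 'w) \<Rightarrow> ('x \<Rightarrow> 'w) \<Rightarrow> ('x \<Rightarrow>\<^sub>0 'f) set \<Rightarrow> bool"
  where "presented_by s e R \<longleftrightarrow>
    surj (linear_extension s e) \<and> {f. linear_extension s e f = 0} = module.span free_scale R"


section \<open>Restricted Lie algebras\<close>

locale lie_algebra = vector_space scale
  for scale :: "'f::field \<Rightarrow> 'g::ab_group_add \<Rightarrow> 'g" +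
  fixes bracket :: "'g \<Rightarrow> 'g \<Rightarrow> 'g"
  assumes bracket_bilinear: "bilinear_map scale scale scale bracket"
    and bracket_self: "bracket x x = 0"
    and bracket_jacobi:
      "bracket x (bracket y z) + bracket y (bracket z x) + bracket z (bracket x y) = 0"

text \<open>
  Here \<open>'g poly\<close> stands for \<open>\<gg> \<otimes> F[X]\<close>, and \<open>ad_linear_poly bracket a b\<close> is \<open>ad (a \<otimes> X + b \<otimes> 1)\<close>.
  Jacobson's elements \<open>s\<^sub>i(a, b)\<close>, \<open>1 \<le> i < p\<close>, are determined by
  \<open>(ad (a \<otimes> X + b \<otimes> 1))\<^sup>p\<^sup>-\<^sup>1 (a \<otimes> 1) = (\<Sum>i. i s\<^sub>i(a, b) \<otimes> X\<^sup>i\<^sup>-\<^sup>1)\<close>.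
\<close>

definition ad_linear_poly ::
  "('g::ab_group_add \<Rightarrow> 'g \<Rightarrow> 'g) \<Rightarrow> 'g \<Rightarrow> 'g \<Rightarrow> 'g poly \<Rightarrow> 'g poly"
  where "ad_linear_poly bracket a b q = pCons 0 (map_poly (bracket a) q) + map_poly (bracket b) q"

definition jacobson_s ::
  "('f::field \<Rightarrow> 'g::ab_group_add \<Rightarrow> 'g) \<Rightarrow> ('g \<Rightarrow> 'g \<Rightarrow> 'g) \<Rightarrow> nat \<Rightarrow> 'g \<Rightarrow> 'g \<Rightarrow> 'g"
  where "jacobson_s scale bracket i a b =
    scale (inverse (of_nat i))
      (coeff ((ad_linear_poly bracket a b ^^ (CHAR('f) - 1)) [:a:]) (i - 1))"

locale restricted_lie_algebra = lie_algebra scale bracket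
  for scale :: "'f::field \<Rightarrow> 'g::ab_group_add \<Rightarrow> 'g" and bracket +
  fixes pmap :: "'g \<Rightarrow> 'g"
  assumes prime_char: "prime CHAR('f)"
    and pmap_scale: "pmap (scale c a) = scale (c ^ CHAR('f)) (pmap a)"
    and pmap_add: "pmap (a + b) = pmap a + pmap b + (\<Sum>i=1..<CHAR('f). jacobson_s scale bracket i a b)"
    and pmap_ad: "bracket (pmap a) b = (bracket a ^^ CHAR('f)) b"

definition symmetric_invariant_form ::
  "('f::field \<Rightarrow> 'g::ab_group_add \<Rightarrow> 'g) \<Rightarrow> ('g \<Rightarrow> 'g \<Rightarrow> 'g) \<Rightarrow> ('g \<Rightarrow> 'g \<Rightarrow> 'f) \<Rightarrow> bool"
  where "symmetric_invariant_form scale bracket form \<longleftrightarrow>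
    bilinear_map scale scale (*) form \<and>
    (\<forall>a b. form a b = form b a) \<and>
    (\<forall>a b c. form (bracket a b) c = form a (bracket b c))"


section \<open>The affine Lie algebra and its universal enveloping algebra\<close>

text \<open>
  The pair \<open>(f, c)\<close> stands for \<open>(\<Sum>n. f(n) \<otimes> t\<^sup>n) + c k\<close>.
\<close>

type_synonym ('g, 'f) affine = "(int \<Rightarrow>\<^sub>0 'g) \<times> 'f"

definition affine_scale ::
  "('f::field \<Rightarrow> 'g::ab_group_add \<Rightarrow> 'g) \<Rightarrow> 'f \<Rightarrow> ('g, 'f) affine \<Rightarrow> ('g, 'f) affine"
  where "affine_scale scale c x = (Poly_Mapping.map (scale c) (fst x), c * snd x)"

definition affine_bracket ::
  "('g::ab_group_add \<Rightarrow> 'g \<Rightarrow> 'g) \<Rightarrow> ('g \<Rightarrow> 'g \<Rightarrow> 'f::field)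
    \<Rightarrow> ('g, 'f) affine \<Rightarrow> ('g, 'f) affine \<Rightarrow> ('g, 'f) affine"
  where "affine_bracket bracket form x y =
    (let f = fst x; h = fst y in
      (\<Sum>m\<in>Poly_Mapping.keys f. \<Sum>n\<in>Poly_Mapping.keys h.
         Poly_Mapping.single (m + n) (bracket (Poly_Mapping.lookup f m) (Poly_Mapping.lookup h n)),
       \<Sum>m\<in>Poly_Mapping.keys f. \<Sum>n\<in>Poly_Mapping.keys h.
         if m + n = 0 then of_int m * form (Poly_Mapping.lookup f m) (Poly_Mapping.lookup h n) else 0))"

definition mode :: "'g::ab_group_add \<Rightarrow> int \<Rightarrow> ('g, 'f::field) affine"
  where "mode a n = (Poly_Mapping.single n a, 0)"

text \<open>The subalgebra \<open>\<gg>[t] \<oplus> F k\<close> and the character by which it acts on the one-dimensional module of level \<open>level\<close>.\<close>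

definition affine_nonneg :: "('g::ab_group_add, 'f::field) affine set"
  where "affine_nonneg = {x. \<forall>n<0. Poly_Mapping.lookup (fst x) n = 0}"

definition level_char :: "'f::field \<Rightarrow> ('g::ab_group_add, 'f) affine \<Rightarrow> 'f"
  where "level_char level x = snd x * level"

text \<open>
  Words \<open>'h list\<close> are a basis of the free associative algebra on the set \<open>'h\<close>. The relators span the
  two-sided ideal generated by \<open>[x + y] - [x] - [y]\<close>, \<open>[c x] - c [x]\<close> (which give the tensor algebra)
  and \<open>x y - y x - [x, y]\<close>.
\<close>

definition enveloping_relators ::
  "('f::field \<Rightarrow> 'h::ab_group_add \<Rightarrow> 'h) \<Rightarrow> ('h \<Rightarrow> 'h \<Rightarrow> 'h) \<Rightarrow> ('h list \<Rightarrow>\<^sub>0 'f) set"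
  where "enveloping_relators scale bracket =
    {basis_vec (v @ [x + y] @ w) - basis_vec (v @ [x] @ w) - basis_vec (v @ [y] @ w) | v w x y. True} \<union>
    {basis_vec (v @ [scale c x] @ w) - free_scale c (basis_vec (v @ [x] @ w)) | v w c x. True} \<union>
    {basis_vec (v @ [x, y] @ w) - basis_vec (v @ [y, x] @ w) - basis_vec (v @ [bracket x y] @ w)
      | v w x y. True}"

definition eval_word :: "('h \<Rightarrow> 'u::monoid_mult) \<Rightarrow> 'h list \<Rightarrow> 'u"
  where "eval_word \<iota> w = prod_list (map \<iota> w)"

locale enveloping_algebra = assoc_algebra scaleU
  for scaleU :: "'f::field \<Rightarrow> 'u::ring_1 \<Rightarrow> 'u" +
  fixes scale :: "'f \<Rightarrow> 'h::ab_group_add \<Rightarrow> 'h" and bracket :: "'h \<Rightarrow> 'h \<Rightarrow> 'h" and \<iota> :: "'h \<Rightarrow> 'u"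
  assumes presented: "presented_by scaleU (eval_word \<iota>) (enveloping_relators scale bracket)"


section \<open>The vacuum module\<close>

text \<open>
  Relators of \<open>U(h) \<otimes>\<^sub>U\<^sub>(\<^sub>b\<^sub>) F\<close>, where the subalgebra \<open>b\<close> of \<open>h\<close> acts on \<open>F\<close> by the character
  \<open>\<kappa>\<close>. An element of \<open>U(b)\<close> is given by a representative \<open>f\<close> in the free associative algebra on \<open>b\<close>;
  it acts on \<open>U(h)\<close> by right multiplication with its image, and on \<open>F\<close> by the value of the
  extension of \<open>\<kappa>\<close>.
\<close>

definition induced_relators ::
  "('f::field \<Rightarrow> 'u::ring_1 \<Rightarrow> 'u) \<Rightarrow> ('h \<Rightarrow> 'u) \<Rightarrow> 'h set \<Rightarrow> ('h \<Rightarrow> 'f) \<Rightarrow> (('u \<times> 'f) \<Rightarrow>\<^sub>0 'f) set"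
  where "induced_relators scaleU \<iota> b \<kappa> =
    {basis_vec (u + u', c) - basis_vec (u, c) - basis_vec (u', c) | u u' c. True} \<union>
    {basis_vec (u, c + c') - basis_vec (u, c) - basis_vec (u, c') | u c c'. True} \<union>
    {basis_vec (scaleU k u, c) - free_scale k (basis_vec (u, c)) | k u c. True} \<union>
    {basis_vec (u, k * c) - free_scale k (basis_vec (u, c)) | k u c. True} \<union>
    {basis_vec (u * linear_extension scaleU (eval_word \<iota>) f, c)
        - basis_vec (u, linear_extension (*) (eval_word \<kappa>) f * c)
      | u c f. Poly_Mapping.keys f \<subseteq> lists b}"

text \<open>
  \<open>'v\<close> is \<open>U(h) \<otimes>\<^sub>U\<^sub>(\<^sub>b\<^sub>) F\<close> with \<open>h\<close>-action \<open>act\<close>; the pure tensor of \<open>u\<close> and \<open>c\<close> is \<open>tens (u, c)\<close>.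
\<close>

locale induced_module = vector_space scaleV
  for scaleV :: "'f::field \<Rightarrow> 'v::ab_group_add \<Rightarrow> 'v" +
  fixes scaleU :: "'f \<Rightarrow> 'u::ring_1 \<Rightarrow> 'u" and \<iota> :: "'h \<Rightarrow> 'u" and b :: "'h set" and \<kappa> :: "'h \<Rightarrow> 'f"
    and tens :: "'u \<times> 'f \<Rightarrow> 'v" and act :: "'h \<Rightarrow> 'v \<Rightarrow> 'v"
  assumes presented: "presented_by scaleV tens (induced_relators scaleU \<iota> b \<kappa>)"
    and act_linear: "Vector_Spaces.linear scaleV scaleV (act x)"
    and act_tens: "act x (tens (u, c)) = tens (\<iota> x * u, c)"

locale affine_vacuum_module =
  U: enveloping_algebra scaleU "affine_scale scale" "affine_bracket bracket form" \<iota> +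
  V: induced_module scaleV scaleU \<iota> affine_nonneg "level_char level" tens act
  for scale :: "'f::field \<Rightarrow> 'g::ab_group_add \<Rightarrow> 'g"
    and bracket :: "'g \<Rightarrow> 'g \<Rightarrow> 'g" and form :: "'g \<Rightarrow> 'g \<Rightarrow> 'f" and level :: 'f
    and scaleU :: "'f \<Rightarrow> 'u::ring_1 \<Rightarrow> 'u" and \<iota> :: "('g, 'f) affine \<Rightarrow> 'u"
    and scaleV :: "'f \<Rightarrow> 'v::ab_group_add \<Rightarrow> 'v" and tens :: "'u \<times> 'f \<Rightarrow> 'v"
    and act :: "('g, 'f) affine \<Rightarrow> 'v \<Rightarrow> 'v" and vac :: 'v +
  assumes vac: "vac = tens (1, 1)"

definition submodule ::
  "('f::field \<Rightarrow> 'v::ab_group_add \<Rightarrow> 'v) \<Rightarrow> ('h \<Rightarrow> 'v \<Rightarrow> 'v) \<Rightarrow> 'v set \<Rightarrow> bool"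
  where "submodule scaleV act W \<longleftrightarrow> module.subspace scaleV W \<and> (\<forall>x. \<forall>w\<in>W. act x w \<in> W)"

definition submodule_generated ::
  "('f::field \<Rightarrow> 'v::ab_group_add \<Rightarrow> 'v) \<Rightarrow> ('h \<Rightarrow> 'v \<Rightarrow> 'v) \<Rightarrow> 'v set \<Rightarrow> 'v set"
  where "submodule_generated scaleV act S = submodule scaleV act hull S"


section \<open>Vertex algebras\<close>

text \<open>
  \<open>Y u n\<close> is the mode \<open>u\<^sub>n\<close>, so that \<open>Y(u, x) = (\<Sum>n. u\<^sub>n x\<^sup>-\<^sup>n\<^sup>-\<^sup>1)\<close>. The axiom \<open>jacobi\<close> equates the
  coefficients of \<open>x\<^sub>0\<^sup>-\<^sup>l\<^sup>-\<^sup>1 x\<^sub>1\<^sup>-\<^sup>m\<^sup>-\<^sup>1 x\<^sub>2\<^sup>-\<^sup>n\<^sup>-\<^sup>1\<close> on the two sides of the Jacobi identity. By definition of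
  the delta series, \<open>x\<^sub>0\<^sup>-\<^sup>1 \<delta>((x\<^sub>1 - x\<^sub>2) / x\<^sub>0)\<close> is the sum of \<open>x\<^sub>0\<^sup>-\<^sup>k\<^sup>-\<^sup>1 (x\<^sub>1 - x\<^sub>2)\<^sup>k\<close> over all integers \<open>k\<close>, which
  contributes \<open>k = l\<close>; the second term likewise. On the right, \<open>x\<^sub>2\<^sup>-\<^sup>k\<^sup>-\<^sup>1 (x\<^sub>1 - x\<^sub>0)\<^sup>k\<close> contributes with
  \<open>x\<^sub>1\<close>-exponent \<open>k - i = -m - 1\<close>, that is \<open>k = i - m - 1\<close>. By the truncation axiom all
  three sums have finite support. Binomial coefficients are formed over the integers and then mapped
  to the field, since \<open>fact i\<close> need not be invertible there.
\<close>

definition int_binomial :: "int \<Rightarrow> nat \<Rightarrow> int"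
  where "int_binomial a i = (\<Prod>j<i. a - int j) div fact i"

locale vertex_algebra = vector_space scale
  for scale :: "'f::field \<Rightarrow> 'v::ab_group_add \<Rightarrow> 'v" +
  fixes Y :: "'v \<Rightarrow> int \<Rightarrow> 'v \<Rightarrow> 'v" and vac :: 'v
  assumes Y_bilinear: "bilinear_map scale scale scale (\<lambda>u v. Y u n v)"
    and truncation: "\<exists>N. \<forall>n\<ge>N. Y u n v = 0"
    and vacuum: "Y vac n v = (if n = -1 then v else 0)"
    and creation_regular: "n \<ge> 0 \<Longrightarrow> Y v n vac = 0"
    and creation: "Y v (-1) vac = v"
    and jacobi:
      "(Sum_any (\<lambda>i. scale ((-1) ^ i * of_int (int_binomial l i)) (Y u (m + l - int i) (Y v (n + int i) w))))
        - (Sum_any (\<lambda>i. scale ((-1) powi l * (-1) ^ i * of_int (int_binomial l i))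
             (Y v (n + l - int i) (Y u (m + int i) w))))
       = (Sum_any (\<lambda>i. scale ((-1) ^ i * of_int (int_binomial (int i - m - 1) i))
             (Y (Y u (l + int i) v) (m + n - int i) w)))"

definition va_ideal ::
  "('f::field \<Rightarrow> 'v::ab_group_add \<Rightarrow> 'v) \<Rightarrow> ('v \<Rightarrow> int \<Rightarrow> 'v \<Rightarrow> 'v) \<Rightarrow> 'v set \<Rightarrow> bool"
  where "va_ideal scale Y I \<longleftrightarrow>
    module.subspace scale I \<and> (\<forall>v. \<forall>w\<in>I. \<forall>n. Y v n w \<in> I \<and> Y w n v \<in> I)"

definition va_ideal_generated ::
  "('f::field \<Rightarrow> 'v::ab_group_add \<Rightarrow> 'v) \<Rightarrow> ('v \<Rightarrow> int \<Rightarrow> 'v \<Rightarrow> 'v) \<Rightarrow> 'v set \<Rightarrow> 'v set"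
  where "va_ideal_generated scale Y S = va_ideal scale Y hull S"


section \<open>The submodule attached to a linear functional\<close>

text \<open>\<open>(a(-m)\<^sup>p - a\<^sup>[\<^sup>p\<^sup>](-pm) - \<delta>\<^sub>m\<^sub>1 \<chi>(a)\<^sup>p) 1\<close>, where \<open>p\<close> is the characteristic of the field.\<close>

definition p_vector ::
  "('g::ab_group_add \<Rightarrow> 'g) \<Rightarrow> ('g \<Rightarrow> 'f::field) \<Rightarrow> ('f \<Rightarrow> 'v::ab_group_add \<Rightarrow> 'v)
    \<Rightarrow> (('g, 'f) affine \<Rightarrow> 'v \<Rightarrow> 'v) \<Rightarrow> 'v \<Rightarrow> 'g \<Rightarrow> nat \<Rightarrow> 'v"
  where "p_vector pmap \<chi> scaleV act vac a m =
    (act (mode a (- int m)) ^^ CHAR('f)) vac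
      - act (mode (pmap a) (- int (CHAR('f) * m))) vac
      - scaleV (if m = 1 then \<chi> a ^ CHAR('f) else 0) vac"

end

theory Submission
  imports Defs
begin

text \<open>
  Let \<open>D\<^sub>k v = v\<^sub>-\<^sub>k\<^sub>-\<^sub>1 1\<close> be the Hasse derivatives (\<open>hasse\<close>). Skew symmetry expresses the
  modes of \<open>w\<close> through the \<open>D\<^sub>i\<close> and left multiplication, and the iterate formula reduces left
  multiplication to the action of the modes \<open>a(n)\<close>; so a submodule is an ideal as soon as it is stable
  under all \<open>D\<^sub>k\<close>. Write \<open>w(a, m)\<close> for the generators of \<open>J\<close>. The negative modes of a
  fixed \<open>a\<close> commute, so in characteristic \<open>p\<close> the translate of \<open>a(-m)\<^sup>p\<close> is the series of \<open>p\<close>-th powers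
  of the terms of the translate of \<open>a(-m)\<close>. This gives \<open>D\<^sub>k w(a, m) = 0\<close> unless \<open>k = p j\<close>, in which case
  \<open>D\<^sub>k w(a, m)\<close> is \<open>w(a, m + j)\<close> times the binomial coefficient of \<open>m + j - 1\<close> over \<open>j\<close>. Hence \<open>J\<close> is
  stable under the \<open>D\<^sub>k\<close>, and since the coefficient is \<open>1\<close> for \<open>m = 1\<close>, every \<open>w(a, m)\<close> lies in the
  ideal generated by the \<open>w(a, 1)\<close>.
\<close>

subsection \<open>The Frobenius map on commuting elements\<close>

lemma binomial_commuting:
  fixes x y :: "'a::semiring_1"
  assumes "x * y = y * x"
  shows "(x + y) ^ n = (\<Sum>k\<le>n. of_nat (n choose k) * (x ^ k * y ^ (n - k)))"
proof (induction n)
  case 0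
  then show ?case by simp
next
  case (Suc n)
  define t where "t k = x ^ k * y ^ (Suc n - k)" for k
  have xt: "x * (of_nat c * (x ^ k * y ^ (n - k))) = of_nat c * t (Suc k)" for c k
    by (simp add: t_def) (metis mult.assoc mult_of_nat_commute)
  have yt: "y * (of_nat c * (x ^ k * y ^ (n - k))) = of_nat c * t k" if "k \<le> n" for c k
  proof -
    have "y * x ^ k = x ^ k * y"
      by (rule power_commuting_commutes[OF assms, symmetric])
    then have "y * (x ^ k * y ^ (n - k)) = t k"
      using that by (simp add: t_def Suc_diff_le) (metis mult.assoc)
    then show ?thesis
      by (metis mult.assoc mult_of_nat_commute)
  qed
  have "(x + y) ^ Suc n = (\<Sum>k\<le>n. of_nat (n choose k) * t (Suc k)) + (\<Sum>k\<le>n. of_nat (n choose k) * t k)"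
    by (simp add: Suc.IH distrib_right sum_distrib_left xt yt sum.distrib)
  also have "(\<Sum>k\<le>n. of_nat (n choose k) * t k) = (\<Sum>k\<le>Suc n. of_nat (n choose k) * t k)"
    by (simp add: binomial_eq_0)
  also have "\<dots> = t 0 + (\<Sum>k\<le>n. of_nat (n choose Suc k) * t (Suc k))"
    by (subst sum.atMost_Suc_shift) simp
  also have "(\<Sum>k\<le>n. of_nat (n choose k) * t (Suc k)) + (t 0 + (\<Sum>k\<le>n. of_nat (n choose Suc k) * t (Suc k)))
      = t 0 + (\<Sum>k\<le>n. of_nat (Suc n choose Suc k) * t (Suc k))"
    by (simp add: sum.distrib distrib_right add.left_commute)
  also have "\<dots> = (\<Sum>k\<le>Suc n. of_nat (Suc n choose k) * t k)"
    by (subst sum.atMost_Suc_shift) simp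
  finally show ?case
    by (simp only: t_def)
qed

lemma freshmans_dream_commuting:
  fixes x y :: "'a::semiring_1"
  assumes "x * y = y * x" and "prime p" and "of_nat p = (0 :: 'a)"
  shows "(x + y) ^ p = x ^ p + y ^ p"
proof -
  have p: "p > 0" using assms(2) prime_gt_0_nat by blast
  have z: "of_nat (p choose k) = (0 :: 'a)" if "0 < k" "k < p" for k
  proof -
    have "p dvd (p choose k)"
      using that assms(2) by (intro dvd_choose_prime) auto
    then obtain q where "p choose k = p * q" ..
    then show ?thesis using assms(3) by simp
  qed
  have "(x + y) ^ p = (\<Sum>k\<le>p. of_nat (p choose k) * (x ^ k * y ^ (p - k)))"
    by (rule binomial_commuting[OF assms(1)])
  also have "\<dots> = (\<Sum>k\<in>{0, p}. of_nat (p choose k) * (x ^ k * y ^ (p - k)))"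
    by (rule sum.mono_neutral_right) (auto simp: z)
  also have "\<dots> = x ^ p + y ^ p"
    using p by (simp add: add.commute)
  finally show ?thesis .
qed

lemma power_mult_distrib_commuting:
  fixes x y :: "'a::monoid_mult"
  assumes "x * y = y * x"
  shows "(x * y) ^ n = x ^ n * y ^ n"
proof (induction n)
  case (Suc n)
  have "y * x ^ n = x ^ n * y"
    by (rule power_commuting_commutes[OF assms, symmetric])
  then show ?case
    by (simp add: Suc.IH) (metis mult.assoc)
qed simp

text \<open>Split \<open>F\<close> as its constant term plus \<open>X G\<close>. The two summands
  commute, so \<open>F ^ p\<close> is the sum of \<open>(F $ 0) ^ p\<close> and
  \<open>X ^ p G ^ p\<close>; passing from \<open>F\<close> to \<open>G\<close> lowers the index by
  \<open>p\<close>, which drives the induction on \<open>k\<close>.\<close>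

lemma fps_nth_prime_power_commuting:
  fixes F :: "'a::ring_1 fps"
  assumes "\<And>i j. F $ i * F $ j = F $ j * F $ i" and p: "prime p" and "of_nat p = (0 :: 'a)"
  shows "(F ^ p) $ k = (if p dvd k then (F $ (k div p)) ^ p else 0)"
  using assms(1)
proof (induction k arbitrary: F rule: less_induct)
  case (less k)
  define G where "G = fps_shift 1 F"
  have pos: "p > 0" using p prime_gt_0_nat by blast
  have F: "F = fps_const (F $ 0) + fps_X * G"
    by (rule fps_ext) (simp add: G_def)
  have comm: "fps_const (F $ 0) * (fps_X * G) = fps_X * G * fps_const (F $ 0)"
    by (rule fps_ext) (auto simp: G_def less.prems fps_mult_left_const_nth fps_mult_right_const_nth)
  have char: "of_nat p = (0 :: 'a fps)"
    by (metis assms(3) fps_const_0_eq_0 fps_of_nat)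
  have "F ^ p = fps_const (F $ 0) ^ p + (fps_X * G) ^ p"
    by (subst F) (rule freshmans_dream_commuting[OF comm p char])
  also have "(fps_X * G) ^ p = fps_X ^ p * G ^ p"
    by (rule power_mult_distrib_commuting) (rule fps_mult_fps_X_commute)
  finally have Fp: "(F ^ p) $ k = (if k = 0 then (F $ 0) ^ p else 0) + (if k < p then 0 else (G ^ p) $ (k - p))"
    by (simp add: fps_const_power fps_X_power_mult_nth)
  show ?case
  proof (cases "k < p")
    case True
    then have "p dvd k \<longleftrightarrow> k = 0"
      by (metis dvd_0_right nat_dvd_not_less not_gr_zero)
    then show ?thesis using Fp True by (cases "k = 0") simp_all
  next
    case False
    have "(G ^ p) $ (k - p) = (if p dvd (k - p) then (G $ ((k - p) div p)) ^ p else 0)"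
      using False pos by (intro less.IH) (auto simp: G_def less.prems)
    moreover have "G $ ((k - p) div p) = F $ (k div p)"
      using le_div_geq[of p k] False pos by (simp add: G_def)
    moreover have "p dvd (k - p) \<longleftrightarrow> p dvd k"
      using False by (simp add: dvd_minus_self)
    ultimately show ?thesis
      using Fp False pos by simp
  qed
qed

section \<open>Fermat's little theorem and binomial coefficients modulo \<open>p\<close>\<close>

lemma of_nat_power_prime_char:
  assumes p: "prime p" and "of_nat p = (0 :: 'a::semiring_1)"
  shows "of_nat n ^ p = (of_nat n :: 'a)"
proof (induction n)
  case 0
  then show ?case using p prime_gt_0_nat by (simp add: zero_power)
next
  case (Suc n)
  then show ?case
    using freshmans_dream_commuting[of "of_nat n" "1 :: 'a", OF _ assms]
    by (simp add: add.commute)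
qed

text \<open>The coefficient of \<open>X^i\<close> in the inverse of \<open>(1 - X)^m\<close>; at
  \<open>m = i = 0\<close> the truncated subtraction still gives 1.\<close>

abbreviation rising_coeff :: "nat \<Rightarrow> nat \<Rightarrow> nat"
  where "rising_coeff m i \<equiv> (m + i - 1) choose i"

lemma one_minus_X_power_mult_rising:
  "(1 - fps_X) ^ m * Abs_fps (\<lambda>i. of_nat (rising_coeff m i)) = (1 :: 'a::comm_ring_1 fps)"
proof (induction m)
  case 0
  have "Abs_fps (\<lambda>i. of_nat (rising_coeff 0 i)) = (1 :: 'a fps)"
    by (rule fps_ext) (simp add: binomial_eq_0)
  then show ?case by simp
next
  case (Suc m)
  \<comment> \<open>Pascal's rule: a factor \<open>1 - X\<close> lowers \<open>m\<close> by
    one.\<close>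
  have "(1 - fps_X) * Abs_fps (\<lambda>i. of_nat (rising_coeff (Suc m) i)) = Abs_fps (\<lambda>i. (of_nat (rising_coeff m i) :: 'a))"
  proof (rule fps_ext)
    fix k show "((1 - fps_X) * Abs_fps (\<lambda>i. (of_nat (rising_coeff (Suc m) i) :: 'a))) $ k = Abs_fps (\<lambda>i. of_nat (rising_coeff m i)) $ k"
      by (cases k) (auto simp: algebra_simps)
  qed
  then show ?case
    by (metis (no_types, lifting) Suc.IH mult.assoc power_Suc2)
qed

text \<open>The generating series for \<open>p * m\<close> and the \<open>p\<close>-th power of the
  one for \<open>m\<close> are both inverse to \<open>(1 - X) ^ (p * m)\<close>, hence equal.
  Frobenius and Fermat then give the coefficients.\<close>

lemma rising_coeff_prime_mult:
  assumes p: "prime p" and char: "of_nat p = (0 :: 'a::comm_ring_1)"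
  shows "(of_nat (rising_coeff (p * m) k) :: 'a) = (if p dvd k then of_nat (rising_coeff m (k div p)) else 0)"
proof -
  define R where "R m = Abs_fps (\<lambda>i. (of_nat (rising_coeff m i) :: 'a))" for m
  let ?X = "(1 - fps_X :: 'a fps)"
  have 1: "?X ^ m * R m = 1" for m
    unfolding R_def by (rule one_minus_X_power_mult_rising)
  have 2: "?X ^ (p * m) * R m ^ p = 1"
    by (metis 1 mult.commute power_mult power_mult_distrib power_one)
  have "R (p * m) = (?X ^ (p * m) * R m ^ p) * R (p * m)"
    by (simp only: 2 mult_1)
  also have "\<dots> = (?X ^ (p * m) * R (p * m)) * R m ^ p"
    by (simp only: mult.assoc mult.commute[of "R m ^ p"])
  also have "\<dots> = R m ^ p"
    by (simp only: 1 mult_1)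
  finally have "R (p * m) = R m ^ p" .
  then have "R (p * m) $ k = (R m ^ p) $ k" by simp
  also have "\<dots> = (if p dvd k then (R m $ (k div p)) ^ p else 0)"
    by (rule fps_nth_prime_power_commuting[OF _ p char]) (rule mult.commute)
  finally show ?thesis
    by (simp add: R_def of_nat_power_prime_char[OF p char])
qed

text \<open>Outside \<open>HOL.Binomial\<close> the type of \<open>gchoose\<close> is constrained to fields of characteristic \<open>0\<close>, so
  its properties over the integers are transferred without mentioning it.\<close>

lemmas int_binomial_facts =
  gbinomial_neg[unfolded gbinomial_prod_rev atLeast0LessThan, folded int_binomial_def]
  gbinomial_nneg[unfolded gbinomial_prod_rev atLeast0LessThan, folded int_binomial_def]

lemma int_binomial_0: "int_binomial a 0 = 1"
  by (simp add: int_binomial_def)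

lemma int_binomial_self_minus_one: "int_binomial (int i - 1) i = (if i = 0 then 1 else 0)"
  by (cases i) (auto simp: int_binomial_0 int_binomial_facts binomial_eq_0)

lemma int_binomial_diag: "int_binomial (int i) i = 1"
  by (simp add: int_binomial_facts)

text \<open>Upper negation, for the coefficients in the translate of \<open>a(-m)\<close>.\<close>

lemma signed_int_binomial_neg:
  assumes "m \<ge> 1"
  shows "(-1) ^ i * int_binomial (- int m) i = int (rising_coeff m i)"
proof -
  have "int_binomial (- int m) i = (-1) ^ i * int (i + m - 1 choose i)"
    using assms by (subst int_binomial_facts) simp_all
  then show ?thesis
    by (simp add: add.commute mult.assoc[symmetric] flip: power_mult_distrib)
qed


subsection \<open>Presentations\<close>

lemma lookup_free_scale: "Poly_Mapping.lookup (free_scale c f) x = c * Poly_Mapping.lookup f x"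
  by (simp add: free_scale_def Poly_Mapping.map.rep_eq when_def)

lemma free_scale_vector_space: "vector_space (free_scale :: 'f::field \<Rightarrow> ('x \<Rightarrow>\<^sub>0 'f) \<Rightarrow> _)"
  by unfold_locales
    (simp_all add: poly_mapping_eq_iff fun_eq_iff lookup_add lookup_free_scale algebra_simps)

context vector_space
begin

lemma linear_extension_superset:
  assumes "finite A" "Poly_Mapping.keys f \<subseteq> A"
  shows "linear_extension scale e f = (\<Sum>x\<in>A. scale (Poly_Mapping.lookup f x) (e x))"
  unfolding linear_extension_def using assms
  by (intro sum.mono_neutral_left) (auto simp: in_keys_iff)

lemma linear_extension_basis_vec [simp]: "linear_extension scale e (basis_vec x) = e x"
  by (simp add: linear_extension_def basis_vec_def)

lemma linear_extension_add:
  "linear_extension scale e (f + g) = linear_extension scale e f + linear_extension scale e g"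
proof -
  let ?A = "Poly_Mapping.keys f \<union> Poly_Mapping.keys g"
  have "Poly_Mapping.keys (f + g) \<subseteq> ?A" by (rule Poly_Mapping.keys_add)
  then show ?thesis
    by (simp add: linear_extension_superset[of ?A] lookup_add scale_left_distrib sum.distrib)
qed

lemma linear_extension_free_scale:
  "linear_extension scale e (free_scale c f) = scale c (linear_extension scale e f)"
proof -
  have "Poly_Mapping.keys (free_scale c f) \<subseteq> Poly_Mapping.keys f"
    by (auto simp: in_keys_iff lookup_free_scale)
  then show ?thesis
    by (simp add: linear_extension_superset[of "Poly_Mapping.keys f"] scale_sum_right lookup_free_scale)
qed

lemma linear_extension_diff:
  "linear_extension scale e (f - g) = linear_extension scale e f - linear_extension scale e g"
  by (metis add_diff_cancel diff_add_cancel linear_extension_add)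

lemma presented_by_relator:
  assumes "presented_by scale e R" "r \<in> R"
  shows "linear_extension scale e r = 0"
proof -
  interpret F: vector_space "free_scale :: 'a \<Rightarrow> _" by (rule free_scale_vector_space)
  have "r \<in> F.span R" using assms(2) by (rule F.span_base)
  then show ?thesis using assms(1) unfolding presented_by_def by blast
qed

text \<open>An induction principle: linear properties need checking only on words (for the
  enveloping algebra) or pure tensors (for the induced module).\<close>

lemma presented_by_induct:
  assumes "presented_by scale e R" "subspace S" "\<And>x. e x \<in> S"
  shows "u \<in> S"
proof -
  obtain f where "u = linear_extension scale e f"
    using assms(1) unfolding presented_by_def by (metis surjD)
  then show ?thesis
    unfolding linear_extension_def using assms(2,3)
    by (auto intro!: subspace_sum subspace_scale)
qed

end

context assoc_algebra
begin

lemma scale_of_nat: "scale (of_nat n) x = of_nat n * x"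
  by (induction n) (simp_all add: scale_left_distrib distrib_right)

lemma scale_of_int: "scale (of_int n) x = of_int n * x"
  by (cases n rule: int_diff_cases) (simp add: scale_left_diff_distrib left_diff_distrib scale_of_nat)

lemma of_nat_CHAR_eq_0: "of_nat CHAR('f) = (0 :: 'u)"
  using scale_of_nat[of "CHAR('f)" 1] by simp

end

section \<open>Relations in the enveloping algebra\<close>

context enveloping_algebra
begin

lemma \<iota>_add: "\<iota> (x + y) = \<iota> x + \<iota> y"
proof -
  have "basis_vec ([] @ [x + y] @ []) - basis_vec ([] @ [x] @ []) - basis_vec ([] @ [y] @ [])
      \<in> enveloping_relators scale bracket"
    unfolding enveloping_relators_def by blast
  from presented_by_relator[OF presented this] show ?thesis
    by (simp add: linear_extension_diff linear_extension_add eval_word_def algebra_simps)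
qed

lemma \<iota>_commutator: "\<iota> x * \<iota> y - \<iota> y * \<iota> x = \<iota> (bracket x y)"
proof -
  have "basis_vec ([] @ [x, y] @ []) - basis_vec ([] @ [y, x] @ []) - basis_vec ([] @ [bracket x y] @ [])
      \<in> enveloping_relators scale bracket"
    unfolding enveloping_relators_def by blast
  from presented_by_relator[OF presented this] show ?thesis
    by (simp add: linear_extension_diff eval_word_def)
qed

lemma \<iota>_0: "\<iota> 0 = 0"
  using \<iota>_add[of 0 0] by simp

text \<open>The commutant of \<open>\<iota> x\<close> is a subspace and contains all words, since
  \<open>\<iota> x\<close> commutes with each letter.\<close>

lemma \<iota>_central:
  assumes "\<And>y. bracket x y = 0"
  shows "\<iota> x * u = u * \<iota> x"
proof -
  let ?S = "{u. \<iota> x * u = u * \<iota> x}"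
  have "subspace ?S"
    by (auto simp: subspace_def distrib_left distrib_right simp flip: scale_mult_left scale_mult_right)
  moreover have "eval_word \<iota> w \<in> ?S" for w
  proof (induction w)
    case (Cons y w)
    have "\<iota> x * \<iota> y = \<iota> y * \<iota> x"
      using \<iota>_commutator[of x y] assms[of y] by (simp add: \<iota>_0)
    then show ?case
      using Cons by (simp add: eval_word_def) (metis mult.assoc)
  qed (simp add: eval_word_def)
  ultimately show ?thesis
    using presented_by_induct[OF presented] by blast
qed

end

section \<open>Relations in the induced module\<close>

context induced_module
begin

lemma tens_relator:
  assumes "r \<in> induced_relators scaleU \<iota> b \<kappa>"
  shows "linear_extension scaleV tens r = 0"
  by (rule presented_by_relator[OF presented assms])

lemma tens_add_left: "tens (u + u', c) = tens (u, c) + tens (u', c)"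
proof -
  have "basis_vec (u + u', c) - basis_vec (u, c) - basis_vec (u', c)
      \<in> induced_relators scaleU \<iota> b \<kappa>"
    unfolding induced_relators_def by blast
  from tens_relator[OF this] show ?thesis by (simp add: linear_extension_diff linear_extension_add algebra_simps)
qed

lemma tens_0_left: "tens (0, c) = 0"
  using tens_add_left[of 0 0 c] by simp

lemma tens_sum_left: "tens (\<Sum>i\<in>A. f i, c) = (\<Sum>i\<in>A. tens (f i, c))"
  by (induction A rule: infinite_finite_induct) (simp_all add: tens_0_left tens_add_left)

lemma tens_scale_left: "tens (scaleU k u, c) = scaleV k (tens (u, c))"
proof -
  have "basis_vec (scaleU k u, c) - free_scale k (basis_vec (u, c)) \<in> induced_relators scaleU \<iota> b \<kappa>"
    unfolding induced_relators_def by blast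
  from tens_relator[OF this] show ?thesis
    by (simp add: linear_extension_diff linear_extension_free_scale)
qed

lemma tens_scale_right: "tens (u, k * c) = scaleV k (tens (u, c))"
proof -
  have "basis_vec (u, k * c) - free_scale k (basis_vec (u, c)) \<in> induced_relators scaleU \<iota> b \<kappa>"
    unfolding induced_relators_def by blast
  from tens_relator[OF this] show ?thesis
    by (simp add: linear_extension_diff linear_extension_free_scale)
qed

text \<open>The balancing relation over \<open>U(b)\<close> for the element represented by the
  one-letter word \<open>[x]\<close>.\<close>

lemma tens_character:
  assumes "vector_space scaleU" "x \<in> b"
  shows "tens (u * \<iota> x, c) = tens (u, \<kappa> x * c)"
proof -
  interpret U: vector_space scaleU by fact
  interpret F: vector_space "(*) :: 'f \<Rightarrow> _ \<Rightarrow> 'f" by unfold_locales (auto simp: algebra_simps)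
  have "Poly_Mapping.keys (basis_vec [x] :: _ \<Rightarrow>\<^sub>0 'f) \<subseteq> lists b"
    using assms(2) by (simp add: basis_vec_def)
  then have "basis_vec (u * linear_extension scaleU (eval_word \<iota>) (basis_vec [x]), c)
        - basis_vec (u, linear_extension (*) (eval_word \<kappa>) (basis_vec [x]) * c) \<in> induced_relators scaleU \<iota> b \<kappa>"
    unfolding induced_relators_def by blast
  from tens_relator[OF this] show ?thesis
    by (simp add: linear_extension_diff eval_word_def)
qed

lemma act_add_right: "act x (v + w) = act x v + act x w"
  using act_linear[of x] unfolding Vector_Spaces.linear_iff by blast

lemma act_scale_right: "act x (scaleV c v) = scaleV c (act x v)"
  using act_linear[of x] unfolding Vector_Spaces.linear_iff by blast

lemma act_0_right: "act x 0 = 0"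
  using act_add_right[of x 0 0] by simp

end

subsection \<open>Hasse derivatives in a vertex algebra\<close>

text \<open>No finiteness is assumed: over an infinite support the sum has the default value 0,
  which lies in \<open>S\<close>.\<close>

lemma (in vector_space) subspace_Sum_any:
  assumes "subspace S" "\<And>i. f i \<in> S"
  shows "Sum_any f \<in> S"
  unfolding Sum_any.expand_set using assms by (intro subspace_sum) auto

lemma Sum_any_only_0:
  fixes f :: "nat \<Rightarrow> 'a::comm_monoid_add"
  assumes "\<And>i. i > 0 \<Longrightarrow> f i = 0"
  shows "Sum_any f = f 0"
proof -
  have "{i. f i \<noteq> 0} \<subseteq> {0}" using assms by auto
  then show ?thesis by (subst Sum_any.expand_superset[of "{0}"]) auto
qed

context vertex_algebra
begin

lemma Y_add_left: "Y (u + v) n w = Y u n w + Y v n w"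
  and Y_add_right: "Y u n (v + w) = Y u n v + Y u n w"
  and Y_scale_left: "Y (scale c u) n w = scale c (Y u n w)"
  and Y_scale_right: "Y u n (scale c w) = scale c (Y u n w)"
  using Y_bilinear unfolding bilinear_map_def Vector_Spaces.linear_iff by blast+

lemma Y_0_left: "Y 0 n w = 0"
  using Y_add_left[of 0 0 n w] by simp

lemma Y_0_right: "Y u n 0 = 0"
  using Y_add_right[of u n 0 0] by simp

text \<open>The coefficient of \<open>x^k\<close> in \<open>Y(v, x) 1\<close>. It replaces
  \<open>D_1^k / k!\<close>, which makes no sense in characteristic \<open>p\<close> once
  \<open>k \<ge> p\<close>.\<close>

definition hasse :: "nat \<Rightarrow> 'v \<Rightarrow> 'v"
  where "hasse k v = Y v (- int k - 1) vac"

lemma hasse_add: "hasse k (u + v) = hasse k u + hasse k v"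
  by (simp add: hasse_def Y_add_left)

lemma hasse_scale: "hasse k (scale c u) = scale c (hasse k u)"
  by (simp add: hasse_def Y_scale_left)

lemma hasse_zero: "hasse k 0 = 0"
  by (simp add: hasse_def Y_0_left)

lemma hasse_diff: "hasse k (u - v) = hasse k u - hasse k v"
  by (metis add_diff_cancel diff_add_cancel hasse_add)

lemma hasse_0: "hasse 0 v = v"
  by (simp add: hasse_def creation)

lemma hasse_vac: "hasse k vac = (if k = 0 then vac else 0)"
  by (simp add: hasse_def vacuum)

text \<open>The Jacobi identity at \<open>m = 0\<close>: on the right the binomial coefficient of
  \<open>i - 1\<close> over \<open>i\<close> vanishes for \<open>i > 0\<close>.\<close>

lemma iterate_formula:
  "Y (Y u l v) n w =
     Sum_any (\<lambda>i. scale ((-1) ^ i * of_int (int_binomial l i)) (Y u (l - int i) (Y v (n + int i) w)))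
     - Sum_any (\<lambda>i. scale ((-1) powi l * (-1) ^ i * of_int (int_binomial l i)) (Y v (n + l - int i) (Y u (int i) w)))"
proof -
  have "Sum_any (\<lambda>i. scale ((-1) ^ i * of_int (int_binomial (int i - 0 - 1) i)) (Y (Y u (l + int i) v) (0 + n - int i) w))
      = Y (Y u l v) n w"
    by (subst Sum_any_only_0) (simp_all add: int_binomial_self_minus_one int_binomial_0)
  with jacobi[of l u 0 v n w] show ?thesis by simp
qed

text \<open>The Jacobi identity applied to the vacuum with \<open>m = -1\<close> and \<open>n = 0\<close>: on the left only
  \<open>v\<^sub>l u\<close> survives, and on the right all binomial coefficients are \<open>1\<close>.\<close>

lemma skew_symmetry:
  "scale ((-1) powi l) (Y v l u) = - Sum_any (\<lambda>i. scale ((-1) ^ i) (hasse i (Y u (l + int i) v)))"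
proof -
  have "Sum_any (\<lambda>i. scale ((-1) ^ i * of_int (int_binomial l i)) (Y u (-1 + l - int i) (Y v (0 + int i) vac))) = 0"
    by (simp add: creation_regular Y_0_right)
  moreover have "Sum_any (\<lambda>i. scale ((-1) powi l * (-1) ^ i * of_int (int_binomial l i))
      (Y v (0 + l - int i) (Y u (-1 + int i) vac))) = scale ((-1) powi l) (Y v l u)"
    by (subst Sum_any_only_0) (simp_all add: creation_regular Y_0_right int_binomial_0 creation)
  moreover have "(\<lambda>i. scale ((-1) ^ i * of_int (int_binomial (int i - (-1) - 1) i))
      (Y (Y u (l + int i) v) (-1 + 0 - int i) vac)) = (\<lambda>i. scale ((-1) ^ i) (hasse i (Y u (l + int i) v)))"
    by (simp add: int_binomial_diag hasse_def minus_diff_commute[of 1])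
  ultimately have "0 - scale ((-1) powi l) (Y v l u) = Sum_any (\<lambda>i. scale ((-1) ^ i) (hasse i (Y u (l + int i) v)))"
    using jacobi[of l u "-1" v 0 vac] by (simp only:)
  then show ?thesis
    by (metis diff_0 minus_minus)
qed

text \<open>The iterate formula on the vacuum with \<open>n = -k - 1\<close>. The creation axiom
  kills the second sum and the terms \<open>i > k\<close> of the first.\<close>

lemma hasse_Y:
  "hasse k (Y u l v) = (\<Sum>i\<le>k. scale ((-1) ^ i * of_int (int_binomial l i)) (Y u (l - int i) (hasse (k - i) v)))"
proof -
  let ?f = "\<lambda>i. scale ((-1) ^ i * of_int (int_binomial l i)) (Y u (l - int i) (Y v (- int k - 1 + int i) vac))"
  have "{i. ?f i \<noteq> 0} \<subseteq> {..k}"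
  proof
    fix i assume "i \<in> {i. ?f i \<noteq> 0}"
    then have "\<not> - int k - 1 + int i \<ge> 0" by (auto simp: creation_regular Y_0_right)
    then show "i \<in> {..k}" by simp
  qed
  then have "Sum_any ?f = sum ?f {..k}" by (intro Sum_any.expand_superset) auto
  also have "\<dots> = (\<Sum>i\<le>k. scale ((-1) ^ i * of_int (int_binomial l i)) (Y u (l - int i) (hasse (k - i) v)))"
    by (intro sum.cong) (auto simp: hasse_def of_nat_diff algebra_simps)
  finally show ?thesis
    using iterate_formula[of u l v "- int k - 1" vac]
    by (simp add: hasse_def creation_regular Y_0_right)
qed

lemma va_ideal_hasse:
  assumes "va_ideal scale Y I" "w \<in> I"
  shows "hasse k w \<in> I"
  using assms by (simp add: va_ideal_def hasse_def)

lemma va_ideal_of_left_ideal: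
  assumes S: "subspace I" and left: "\<And>v n w. w \<in> I \<Longrightarrow> Y v n w \<in> I"
    and hasse: "\<And>k w. w \<in> I \<Longrightarrow> hasse k w \<in> I"
  shows "va_ideal scale Y I"
  unfolding va_ideal_def
proof (intro conjI S allI ballI)
  fix v w n assume w: "w \<in> I"
  show "Y v n w \<in> I" using w by (rule left)
  have "scale ((-1) powi n) (Y w n v) \<in> I"
    unfolding skew_symmetry[of n w v]
    by (intro subspace_neg S subspace_Sum_any subspace_scale hasse left w)
  \<comment> \<open>The sign squares to 1, so scaling by it again removes it.\<close>
  then have "scale ((-1) powi n) (scale ((-1) powi n) (Y w n v)) \<in> I"
    by (rule subspace_scale[OF S])
  moreover have "(-1 :: 'f) powi n * (-1) powi n = 1"
    by (rule power_int_minus_one_mult_self)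
  ultimately show "Y w n v \<in> I"
    by (simp only: scale_scale scale_one)
qed

end

subsection \<open>The vacuum module\<close>

lemma affine_decomposition:
  "x = (\<Sum>n\<in>Poly_Mapping.keys (fst x). mode (Poly_Mapping.lookup (fst x) n) n) + (0, snd x)"
proof (rule prod_eqI)
  have "(\<Sum>n\<in>Poly_Mapping.keys (fst x). Poly_Mapping.single n (Poly_Mapping.lookup (fst x) n)) = fst x"
    by (rule poly_mapping_eqI) (auto simp: lookup_sum lookup_single when_def in_keys_iff)
  then show "fst x = fst ((\<Sum>n\<in>Poly_Mapping.keys (fst x). mode (Poly_Mapping.lookup (fst x) n) n) + (0, snd x))"
    by (simp add: mode_def fst_sum)
  show "snd x = snd ((\<Sum>n\<in>Poly_Mapping.keys (fst x). mode (Poly_Mapping.lookup (fst x) n) n) + (0, snd x))"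
    by (simp add: mode_def snd_sum)
qed

lemma affine_bracket_central: "affine_bracket bracket form (0, c) y = 0"
  by (simp add: affine_bracket_def zero_prod_def)

text \<open>The cocycle lives on \<open>m + n = 0\<close>, which two negative modes never meet; the
  rest of the bracket carries \<open>[a, a]\<close>.\<close>

lemma affine_bracket_mode_self:
  assumes "bracket a a = 0" "m + n \<noteq> 0"
  shows "affine_bracket bracket form (mode a m) (mode a n) = 0"
  using assms by (auto simp: affine_bracket_def mode_def zero_prod_def)

section \<open>Affine vertex algebras: submodules and ideals\<close>

locale affine_vertex_algebra =
  L: lie_algebra scale bracket +
  affine_vacuum_module scale bracket form level scaleU \<iota> scaleV tens act vac +
  VA: vertex_algebra scaleV Y vac
  for scale :: "'f::field \<Rightarrow> 'g::ab_group_add \<Rightarrow> 'g"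
    and bracket :: "'g \<Rightarrow> 'g \<Rightarrow> 'g" and form :: "'g \<Rightarrow> 'g \<Rightarrow> 'f" and level :: 'f
    and scaleU :: "'f \<Rightarrow> 'u::ring_1 \<Rightarrow> 'u" and \<iota> :: "('g, 'f) affine \<Rightarrow> 'u"
    and scaleV :: "'f \<Rightarrow> 'v::ab_group_add \<Rightarrow> 'v" and tens :: "'u \<times> 'f \<Rightarrow> 'v"
    and act :: "('g, 'f) affine \<Rightarrow> 'v \<Rightarrow> 'v" and vac :: 'v
    and Y :: "'v \<Rightarrow> int \<Rightarrow> 'v \<Rightarrow> 'v" +
  assumes Y_mode: "Y (act (mode a (-1)) vac) n = act (mode a n)"
begin

lemma act_add_left: "act (x + y) v = act x v + act y v"
proof -
  have "V.subspace {v. act (x + y) v = act x v + act y v}"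
    by (auto simp: V.subspace_def V.act_add_right V.act_scale_right V.act_0_right V.scale_right_distrib)
  moreover have "act (x + y) (tens z) = act x (tens z) + act y (tens z)" for z
    by (cases z) (simp add: V.act_tens U.\<iota>_add distrib_right V.tens_add_left)
  ultimately show ?thesis
    using V.presented_by_induct[OF V.presented] by blast
qed

lemma act_0_left: "act 0 v = 0"
  using act_add_left[of 0 0 v] by simp

lemma act_sum_left: "act (\<Sum>i\<in>A. f i) v = (\<Sum>i\<in>A. act (f i) v)"
  by (induction A rule: infinite_finite_induct) (simp_all add: act_0_left act_add_left)

text \<open>On a pure tensor the central element moves to the right of \<open>u\<close> and across
  the tensor sign, where it acts by the level.\<close>

lemma act_central: "act (0, c) v = scaleV (c * level) v"
proof -
  have "V.subspace {v. act (0, c) v = scaleV (c * level) v}"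
    by (auto simp: V.subspace_def V.act_add_right V.act_scale_right V.act_0_right V.scale_right_distrib mult.commute)
  moreover have "act (0, c) (tens z) = scaleV (c * level) (tens z)" for z
  proof (cases z)
    case (Pair u d)
    have "act (0, c) (tens z) = tens (u * \<iota> (0, c), d)"
      using U.\<iota>_central[OF affine_bracket_central] by (simp add: Pair V.act_tens)
    also have "\<dots> = tens (u, level_char level (0 :: int \<Rightarrow>\<^sub>0 'g, c) * d)"
      by (rule V.tens_character[OF U.vector_space_axioms]) (simp add: affine_nonneg_def)
    finally show ?thesis by (simp add: Pair level_char_def V.tens_scale_right)
  qed
  ultimately show ?thesis
    using V.presented_by_induct[OF V.presented] by blast
qed

text \<open>Modes and the central line span the affine algebra, and the latter acts by
  scalars.\<close>

lemma submoduleI: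
  assumes S: "V.subspace S" and modes: "\<And>a n v. v \<in> S \<Longrightarrow> act (mode a n) v \<in> S"
  shows "submodule scaleV act S"
  unfolding submodule_def
proof (intro conjI S allI ballI)
  fix x v assume v: "v \<in> S"
  show "act x v \<in> S"
    by (subst affine_decomposition[of x])
      (auto simp: act_add_left act_sum_left act_central intro!: V.subspace_add V.subspace_sum V.subspace_scale S modes v)
qed

text \<open>Words applied to the vacuum give all \<open>tens (u, 1)\<close>, and these span because
  scalars pull out of the second slot.\<close>

lemma vacuum_generates:
  assumes "submodule scaleV act S" "vac \<in> S"
  shows "v \<in> S"
proof -
  have S: "V.subspace S" and act: "\<And>x w. w \<in> S \<Longrightarrow> act x w \<in> S"
    using assms(1) by (auto simp: submodule_def)
  have "U.subspace {u. tens (u, 1) \<in> S}"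
    using S by (auto simp: U.subspace_def V.tens_0_left V.tens_add_left V.tens_scale_left V.subspace_0 V.subspace_add V.subspace_scale)
  moreover have "tens (eval_word \<iota> w, 1) \<in> S" for w
  proof (induction w)
    case Nil
    then show ?case using assms(2) by (simp add: eval_word_def vac)
  next
    case (Cons x w)
    then show ?case using act[of "tens (eval_word \<iota> w, 1)" x] by (simp add: eval_word_def V.act_tens)
  qed
  ultimately have 1: "tens (u, 1) \<in> S" for u
    using U.presented_by_induct[OF U.presented] by blast
  have "tens z \<in> S" for z
  proof (cases z)
    case (Pair u c)
    then show ?thesis
      using V.tens_scale_right[of u c 1] V.subspace_scale[OF S 1] by simp
  qed
  then show ?thesis by (rule V.presented_by_induct[OF V.presented S])
qed

lemma submodule_of_va_ideal:
  assumes "va_ideal scaleV Y I"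
  shows "submodule scaleV act I"
proof (rule submoduleI)
  show "V.subspace I" using assms by (simp add: va_ideal_def)
  show "act (mode a n) v \<in> I" if "v \<in> I" for a n v
    unfolding Y_mode[of a n, symmetric] using assms that by (auto simp only: va_ideal_def)
qed

lemma hasse_act:
  "VA.hasse k (act (mode a l) v) =
    (\<Sum>i\<le>k. scaleV ((-1) ^ i * of_int (int_binomial l i)) (act (mode a (l - int i)) (VA.hasse (k - i) v)))"
  using VA.hasse_Y[of k "act (mode a (-1)) vac" l v] by (simp add: Y_mode)

text \<open>The vectors all of whose modes preserve \<open>I\<close> form a submodule by the iterate
  formula. It contains the vacuum, so it is everything and \<open>I\<close> is a left ideal.\<close>

lemma va_ideal_of_hasse_submodule:
  assumes sub: "submodule scaleV act I" and hasse: "\<And>k w. w \<in> I \<Longrightarrow> VA.hasse k w \<in> I"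
  shows "va_ideal scaleV Y I"
proof (rule VA.va_ideal_of_left_ideal)
  show S: "V.subspace I" using sub by (simp add: submodule_def)
  have act: "act x w \<in> I" if "w \<in> I" for x w
    using sub that unfolding submodule_def by blast
  let ?P = "{v. \<forall>n. \<forall>w\<in>I. Y v n w \<in> I}"
  have "submodule scaleV act ?P"
  proof (rule submoduleI)
    show "V.subspace ?P"
      using S by (auto simp: V.subspace_def VA.Y_0_left VA.Y_add_left VA.Y_scale_left)
  next
    fix a l v assume v: "v \<in> ?P"
    have "Y (act (mode a l) v) n w \<in> I" if w: "w \<in> I" for n w
      using VA.iterate_formula[of "act (mode a (-1)) vac" l v n w] v w
      by (auto simp: Y_mode intro!: V.subspace_diff V.subspace_Sum_any V.subspace_scale S act)
    then show "act (mode a l) v \<in> ?P" by simp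
  qed
  moreover have "vac \<in> ?P"
    using V.subspace_0[OF S] by (simp add: VA.vacuum)
  ultimately show "Y v n w \<in> I" if "w \<in> I" for v n w
    using vacuum_generates that by blast
qed (rule hasse)

lemma submodule_submodule_generated: "submodule scaleV act (submodule_generated scaleV act S)"
  unfolding submodule_generated_def
  by (rule hull_in) (auto simp: submodule_def intro: V.subspace_Inter)

text \<open>Stability under the Hasse derivatives passes from \<open>S\<close> to the submodule. All
  \<open>k\<close> are treated at once, as \<open>hasse_act\<close> relates
  \<open>D_k (a(l) w)\<close> to every \<open>D_j w\<close> with \<open>j \<le> k\<close>.\<close>

lemma va_ideal_submodule_generated:
  assumes "\<And>k s. s \<in> S \<Longrightarrow> VA.hasse k s \<in> submodule_generated scaleV act S"
  shows "va_ideal scaleV Y (submodule_generated scaleV act S)" (is "va_ideal _ _ ?J")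
proof (rule va_ideal_of_hasse_submodule)
  show sub: "submodule scaleV act ?J" by (rule submodule_submodule_generated)
  then have J: "V.subspace ?J" and act: "\<And>x w. w \<in> ?J \<Longrightarrow> act x w \<in> ?J"
    unfolding submodule_def by blast+
  let ?P = "{w. \<forall>k. VA.hasse k w \<in> ?J}"
  have "submodule scaleV act ?P"
  proof (rule submoduleI)
    show "V.subspace ?P"
      using J by (auto simp: V.subspace_def VA.hasse_zero VA.hasse_add VA.hasse_scale)
  next
    fix a l w assume "w \<in> ?P"
    then show "act (mode a l) w \<in> ?P"
      by (auto simp: hasse_act intro!: V.subspace_sum V.subspace_scale J act)
  qed
  then have "?J \<subseteq> ?P"
    unfolding submodule_generated_def
    using assms[unfolded submodule_generated_def] by (intro hull_minimal) auto
  then show "VA.hasse k w \<in> ?J" if "w \<in> ?J" for k w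
    using that by blast
qed

text \<open>The coefficients of \<open>hasse_act\<close>, lifted from operators to the enveloping
  algebra, where the Frobenius lemmas for rings apply.\<close>

definition mode_series :: "'g \<Rightarrow> int \<Rightarrow> 'u fps"
  where "mode_series a l = Abs_fps (\<lambda>i. of_int ((-1) ^ i * int_binomial l i) * \<iota> (mode a (l - int i)))"

lemma tens_of_int: "tens (of_int n * u, c) = scaleV (of_int n) (tens (u, c))"
  by (simp add: V.tens_scale_left flip: U.scale_of_int)

lemma tens_of_nat: "tens (of_nat n * u, c) = scaleV (of_nat n) (tens (u, c))"
  by (simp add: V.tens_scale_left flip: U.scale_of_nat)

text \<open>Conjugation by the exponential of the Hasse derivatives is multiplicative: it replaces
  each factor \<open>a(l)\<close> by its translate \<open>mode_series a l\<close>.\<close>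

lemma hasse_mode_power:
  "VA.hasse k (tens (\<iota> (mode a l) ^ q, 1)) = tens (fps_nth (mode_series a l ^ q) k, 1)"
proof (induction q arbitrary: k)
  case 0
  then show ?case by (simp add: VA.hasse_vac V.tens_0_left flip: vac)
next
  case (Suc q)
  have "VA.hasse k (tens (\<iota> (mode a l) ^ Suc q, 1)) = VA.hasse k (act (mode a l) (tens (\<iota> (mode a l) ^ q, 1)))"
    by (simp add: V.act_tens)
  also have "\<dots> = (\<Sum>i\<le>k. tens (of_int ((-1) ^ i * int_binomial l i)
      * (\<iota> (mode a (l - int i)) * fps_nth (mode_series a l ^ q) (k - i)), 1))"
    unfolding tens_of_int
    by (subst hasse_act) (simp only: Suc.IH V.act_tens of_int_mult of_int_power of_int_minus of_int_1)
  also have "\<dots> = tens (fps_nth (mode_series a l ^ Suc q) k, 1)"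
    by (simp add: fps_mult_nth V.tens_sum_left mode_series_def atLeast0AtMost mult.assoc)
  finally show ?case .
qed

section \<open>Translates of negative modes and their \<open>p\<close>-th powers\<close>

lemma mode_series_nth:
  assumes "m \<ge> 1"
  shows "fps_nth (mode_series a (- int m)) i = of_nat (rising_coeff m i) * \<iota> (mode a (- int (m + i)))"
proof -
  have "- int m - int i = - int (m + i)" by simp
  then show ?thesis
    by (simp only: mode_series_def fps_nth_Abs_fps signed_int_binomial_neg[OF assms] of_int_of_nat_eq)
qed

lemma negative_modes_commute:
  assumes "m \<ge> 1"
  shows "\<iota> (mode a (- int (m + i))) * \<iota> (mode a (- int (m + j))) = \<iota> (mode a (- int (m + j))) * \<iota> (mode a (- int (m + i)))"
  using U.\<iota>_commutator[of "mode a (- int (m + i))" "mode a (- int (m + j))"] assms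
  by (simp add: affine_bracket_mode_self L.bracket_self U.\<iota>_0)

text \<open>The coefficients are integer multiples of negative modes of one \<open>a\<close>, so
  they commute and Frobenius acts coefficientwise; Fermat removes the power from the binomial
  coefficient.\<close>

lemma mode_series_prime_power_nth:
  assumes p: "prime CHAR('f)" and m: "m \<ge> 1"
  shows "fps_nth (mode_series a (- int m) ^ CHAR('f)) k =
    (if CHAR('f) dvd k
     then of_nat (rising_coeff m (k div CHAR('f))) * \<iota> (mode a (- int (m + k div CHAR('f)))) ^ CHAR('f) else 0)"
proof -
  let ?F = "mode_series a (- int m)"
  have "fps_nth ?F i * fps_nth ?F j = fps_nth ?F j * fps_nth ?F i" for i j
    unfolding mode_series_nth[OF m]
    by (metis (no_types, opaque_lifting) mult.assoc mult_of_nat_commute negative_modes_commute[OF m])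
  then have "fps_nth (?F ^ CHAR('f)) k
      = (if CHAR('f) dvd k then fps_nth ?F (k div CHAR('f)) ^ CHAR('f) else 0)"
    by (rule fps_nth_prime_power_commuting[OF _ p U.of_nat_CHAR_eq_0])
  then show ?thesis
    by (simp add: mode_series_nth[OF m] power_mult_distrib_commuting mult_of_nat_commute
        of_nat_power_prime_char[OF p U.of_nat_CHAR_eq_0] del: of_nat_add)
qed

lemma act_power_vac: "(act x ^^ q) vac = tens (\<iota> x ^ q, 1)"
  by (induction q) (simp_all add: vac V.act_tens)

lemma p_vector_tens:
  "p_vector pmap \<chi> scaleV act vac a m =
    tens (\<iota> (mode a (- int m)) ^ CHAR('f), 1) - tens (\<iota> (mode (pmap a) (- int (CHAR('f) * m))), 1)
    - scaleV (if m = 1 then \<chi> a ^ CHAR('f) else 0) vac"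
  using act_power_vac[where x = "mode (pmap a) (- int (CHAR('f) * m))" and q = 1]
  by (simp add: p_vector_def act_power_vac)

text \<open>All three terms acquire the same factor: the \<open>p\<close>-th power by Frobenius, the
  linear term by \<open>rising_coeff_prime_mult\<close>, and the scalar term because only
  \<open>k = 0\<close> contributes.\<close>

lemma hasse_p_vector:
  assumes p: "prime CHAR('f)" and m: "m \<ge> 1"
  shows "VA.hasse k (p_vector pmap \<chi> scaleV act vac a m) =
    (if CHAR('f) dvd k
     then scaleV (of_nat (rising_coeff m (k div CHAR('f)))) (p_vector pmap \<chi> scaleV act vac a (m + k div CHAR('f)))
     else 0)"
proof -
  define j where "j = k div CHAR('f)"
  have pm: "CHAR('f) * m \<ge> 1" using m p prime_gt_0_nat[OF p] by simp
  have 1: "VA.hasse k (tens (\<iota> (mode a (- int m)) ^ CHAR('f), 1)) =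
      (if CHAR('f) dvd k then scaleV (of_nat (rising_coeff m j)) (tens (\<iota> (mode a (- int (m + j))) ^ CHAR('f), 1)) else 0)"
    by (simp only: hasse_mode_power mode_series_prime_power_nth[OF p m] j_def)
      (simp add: tens_of_nat V.tens_0_left)
  have "VA.hasse k (tens (\<iota> (mode (pmap a) (- int (CHAR('f) * m))), 1)) =
      scaleV (of_nat (rising_coeff (CHAR('f) * m) k)) (tens (\<iota> (mode (pmap a) (- int (CHAR('f) * m + k))), 1))"
    using hasse_mode_power[of k "pmap a" "- int (CHAR('f) * m)" 1]
    by (simp only: power_one_right mode_series_nth[OF pm] tens_of_nat)
  also have "\<dots> = (if CHAR('f) dvd k
      then scaleV (of_nat (rising_coeff m j)) (tens (\<iota> (mode (pmap a) (- int (CHAR('f) * (m + j)))), 1)) else 0)"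
    unfolding rising_coeff_prime_mult[OF p of_nat_CHAR]
    by (auto simp: j_def distrib_left)
  finally have 2: "VA.hasse k (tens (\<iota> (mode (pmap a) (- int (CHAR('f) * m))), 1)) = \<dots>" .
  have 3: "VA.hasse k (scaleV (if m = 1 then \<chi> a ^ CHAR('f) else 0) vac) =
      (if CHAR('f) dvd k then scaleV (of_nat (rising_coeff m j)) (scaleV (if m + j = 1 then \<chi> a ^ CHAR('f) else 0) vac) else 0)"
  proof (cases "k = 0")
    case False
    \<comment> \<open>Here \<open>j \<ge> 1\<close>, so \<open>m + j \<ge> 2\<close> and the scalar
      term is absent on both sides.\<close>
    then have "m + j \<noteq> 1" if "CHAR('f) dvd k"
      using that m by (auto simp: j_def)
    then show ?thesis
      using False by (auto simp: VA.hasse_scale VA.hasse_vac)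
  qed (simp add: VA.hasse_0 j_def)
  show ?thesis
    unfolding p_vector_tens VA.hasse_diff 1 2 3 j_def[symmetric]
    by (auto simp: V.scale_right_diff_distrib)
qed

end

theorem proposition5p6:
  fixes scale :: "'f::alg_closed_field \<Rightarrow> 'g::ab_group_add \<Rightarrow> 'g"
    and bracket :: "'g \<Rightarrow> 'g \<Rightarrow> 'g" and pmap :: "'g \<Rightarrow> 'g"
    and form :: "'g \<Rightarrow> 'g \<Rightarrow> 'f" and level :: 'f and \<chi> :: "'g \<Rightarrow> 'f"
    and scaleU :: "'f \<Rightarrow> 'u::ring_1 \<Rightarrow> 'u" and \<iota> :: "('g, 'f) affine \<Rightarrow> 'u"
    and scaleV :: "'f \<Rightarrow> 'v::ab_group_add \<Rightarrow> 'v" and tens :: "'u \<times> 'f \<Rightarrow> 'v"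
    and act :: "('g, 'f) affine \<Rightarrow> 'v \<Rightarrow> 'v" and vac :: 'v
    and Y :: "'v \<Rightarrow> int \<Rightarrow> 'v \<Rightarrow> 'v" and J :: "'v set"
  assumes "prime CHAR('f)" and "CHAR('f) \<ge> 3"
    and "restricted_lie_algebra scale bracket pmap"
    and "symmetric_invariant_form scale bracket form"
    and "Vector_Spaces.linear scale (*) \<chi>"
    and "affine_vacuum_module scale bracket form level scaleU \<iota> scaleV tens act vac"
    and "vertex_algebra scaleV Y vac"
    and "\<And>a n. Y (act (mode a (-1)) vac) n = act (mode a n)"
    and J_def: "J = submodule_generated scaleV act
      {p_vector pmap \<chi> scaleV act vac a m | a m. m \<ge> 1}"
  shows "va_ideal scaleV Y J \<and>
    J = va_ideal_generated scaleV Y {p_vector pmap \<chi> scaleV act vac a 1 | a. True}"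
proof -
  interpret affine_vertex_algebra scale bracket form level scaleU \<iota> scaleV tens act vac Y
    using assms by (simp add: affine_vertex_algebra_def affine_vertex_algebra_axioms_def restricted_lie_algebra_def)
  let ?w = "p_vector pmap \<chi> scaleV act vac"
  let ?G = "{?w a m | a m. m \<ge> 1}" and ?G1 = "{?w a 1 | a. True}"
  note p = \<open>prime CHAR('f)\<close>
  have gen: "?w a m \<in> J" if "m \<ge> 1" for a m
    unfolding J_def submodule_generated_def using that by (intro hull_inc) blast
  have sub: "V.subspace J"
    using submodule_submodule_generated unfolding J_def submodule_def by blast
  have ideal: "va_ideal scaleV Y J"
    unfolding J_def
  proof (rule va_ideal_submodule_generated, fold J_def)
    fix k s assume "s \<in> ?G"
    then obtain a m where "s = ?w a m" "m \<ge> 1" by blast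
    then show "VA.hasse k s \<in> J"
      using gen by (auto simp: hasse_p_vector[OF p] intro: V.subspace_scale V.subspace_0 sub)
  qed
  moreover have "va_ideal_generated scaleV Y ?G1 \<subseteq> J"
    unfolding va_ideal_generated_def using gen by (intro hull_minimal ideal) auto
  \<comment> \<open>Ideals are submodules, so only the generators of \<open>J\<close> need to be
    found in \<open>I\<close>.\<close>
  moreover have "J \<subseteq> I" if I: "va_ideal scaleV Y I" "?G1 \<subseteq> I" for I
    unfolding J_def submodule_generated_def
  proof (intro hull_minimal submodule_of_va_ideal I subsetI)
    fix s assume "s \<in> ?G"
    then obtain a m where s: "s = ?w a m" "m \<ge> 1" by blast
    \<comment> \<open>The order \<open>p (m - 1)\<close> shifts the index from 1 to
      \<open>m\<close>, with coefficient \<open>m - 1\<close> over \<open>m - 1\<close>, that is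
      1.\<close>
    have "VA.hasse (CHAR('f) * (m - 1)) (?w a 1) = s"
      using s prime_gt_0_nat[OF p] by (simp add: hasse_p_vector[OF p])
    then show "s \<in> I"
      using VA.va_ideal_hasse[OF I(1)] I(2) by blast
  qed
  \<comment> \<open>The hull is the intersection of all such \<open>I\<close>.\<close>
  then have "J \<subseteq> va_ideal_generated scaleV Y ?G1"
    unfolding va_ideal_generated_def hull_def by blast
  ultimately show ?thesis by blast
qed

end
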